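(* For all $a,b\in\mathbb{N}$, the $1$-leaky forcing number of the Hopi rectangle graph $HD(a,b)$ is $Z_{(1)}(HD(a,b))=a+b$.
   Context: All graphs are finite, simple and undirected; $\mathbb{N}$ denotes the positive integers. Hopi rectangle graph: for $a,b\in\mathbb{N}$, view the vertices of the grid graph $P_{a+b}\square P_{a+b}$ as the integer pairs $(i,j)$ with $0\le i,j\le a+b-1$, two pairs being adjacent iff they differ by $\pm(1,0)$ or $\pm(0,1)$. The Hopi rectangle graph $HD(a,b)$ of order $(a,b)$ is the subgraph of $P_{a+b}\square P_{a+b}$ induced by the vertex set $$\{(i,j): a-1\le i+j\le 2b+a-1 \text{ and } |i-j|\le a\}.$$ Zero forcing color change rule: given a coloring of $V(G)$ in blue and white, a blue vertex $u$ having exactly one white neighbor $v$ may force $v$ to become blue. For an integer $\ell\ge0$, a set $B\subseteq V(G)$ is an $\ell$-leaky forcing set if for every choice of a set $L\subseteq V(G)$ of at most $\ell$ vertices (the leaks), starting with exactly the vertices of $B$ blue and repeatedly applying the color change rule, where vertices of $L$ are not allowed to perform forces, all vertices of $G$ eventually become blue. The $\ell$-leaky forcing number $Z_{(\ell)}(G)$ is the minimum cardinality of an $\ell$-leaky forcing set of $G$. *)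

theory Defs
  imports "Graph_Theory.Graph_Theory"
begin

text \<open>
  A finite simple undirected graph is an instance of the library locale \<^locale>\<open>graph\<close>:
  a finite digraph without loops and parallel arcs whose arc relation is symmetric.
  Adjacency of \<open>u\<close> and \<open>v\<close> is \<open>u \<rightarrow>\<^bsub>G\<^esub> v\<close>.
\<close>

definition neighbors :: "('v, 'e) pre_digraph \<Rightarrow> 'v \<Rightarrow> 'v set" where
  "neighbors G u = {v \<in> verts G. u \<rightarrow>\<^bsub>G\<^esub> v}"

text \<open>
  A coloring is given by its set of blue vertices.  One step is a single force
  performed by a blue vertex outside the set \<open>L\<close> of leaks.
\<close>

definition force_step :: "('v, 'e) pre_digraph \<Rightarrow> 'v set \<Rightarrow> 'v set \<Rightarrow> 'v set \<Rightarrow> bool" where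
  "force_step G L S T \<longleftrightarrow>
     (\<exists>u v. u \<in> S \<and> u \<notin> L \<and> neighbors G u - S = {v} \<and> T = insert v S)"

definition leaky_forcing_set :: "nat \<Rightarrow> ('v, 'e) pre_digraph \<Rightarrow> 'v set \<Rightarrow> bool" where
  "leaky_forcing_set l G B \<longleftrightarrow>
     B \<subseteq> verts G \<and>
     (\<forall>L. L \<subseteq> verts G \<and> card L \<le> l \<longrightarrow> (force_step G L)\<^sup>*\<^sup>* B (verts G))"

definition leaky_forcing_number :: "nat \<Rightarrow> ('v, 'e) pre_digraph \<Rightarrow> nat" where
  "leaky_forcing_number l G = (LEAST k. \<exists>B. leaky_forcing_set l G B \<and> card B = k)"

lemma leaky_forcing_set_verts: "leaky_forcing_set l G (verts G)"
  by (simp add: leaky_forcing_set_def)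

lemma leaky_forcing_number_attained:
  "\<exists>B. leaky_forcing_set l G B \<and> card B = leaky_forcing_number l G"
  unfolding leaky_forcing_number_def
  by (rule LeastI_ex) (use leaky_forcing_set_verts in blast)

lemma leaky_forcing_number_le: "leaky_forcing_set l G B \<Longrightarrow> leaky_forcing_number l G \<le> card B"
  unfolding leaky_forcing_number_def by (rule Least_le) blast

text \<open>The grid graph \<open>P\<^sub>n \<box> P\<^sub>n\<close> on integer pairs.\<close>

definition grid_graph :: "nat \<Rightarrow> (int \<times> int) pair_pre_digraph" where
  "grid_graph n =
     \<lparr> pverts = {0..int n - 1} \<times> {0..int n - 1},
       parcs = {(p, q). p \<in> {0..int n - 1} \<times> {0..int n - 1} \<and>
                        q \<in> {0..int n - 1} \<times> {0..int n - 1} \<and>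
                        (fst q - fst p, snd q - snd p) \<in> {(1, 0), (-1, 0), (0, 1), (0, -1)}} \<rparr>"

definition hopi_rectangle ::
    "nat \<Rightarrow> nat \<Rightarrow> (int \<times> int, (int \<times> int) \<times> (int \<times> int)) pre_digraph" where
  "hopi_rectangle a b =
     with_proj (grid_graph (a + b)) \<restriction>
       {(i, j). (i, j) \<in> pverts (grid_graph (a + b)) \<and>
                int a - 1 \<le> i + j \<and> i + j \<le> 2 * int b + int a - 1 \<and> \<bar>i - j\<bar> \<le> int a}"

lemma pair_graph_grid_graph: "pair_graph (grid_graph n)"
proof
  have "parcs (grid_graph n) \<subseteq> pverts (grid_graph n) \<times> pverts (grid_graph n)"
    by (auto simp: grid_graph_def)
  moreover show "finite (pverts (grid_graph n))"
    by (simp add: grid_graph_def)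
  ultimately show "finite (parcs (grid_graph n))"
    by (meson finite_SigmaI finite_subset)
qed (auto simp: grid_graph_def symmetric_def sym_def)

lemma verts_hopi_rectangle:
  "verts (hopi_rectangle a b) =
     {(i, j). 0 \<le> i \<and> i \<le> int (a + b) - 1 \<and> 0 \<le> j \<and> j \<le> int (a + b) - 1 \<and>
              int a - 1 \<le> i + j \<and> i + j \<le> 2 * int b + int a - 1 \<and> \<bar>i - j\<bar> \<le> int a}"
  by (auto simp: hopi_rectangle_def grid_graph_def)

lemma dominates_hopi_rectangle:
  "p \<rightarrow>\<^bsub>hopi_rectangle a b\<^esub> q \<longleftrightarrow>
     p \<in> verts (hopi_rectangle a b) \<and> q \<in> verts (hopi_rectangle a b) \<and>
     (fst q - fst p, snd q - snd p) \<in> {(1, 0), (-1, 0), (0, 1), (0, -1)}"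
  by (cases p; cases q)
     (auto simp: hopi_rectangle_def grid_graph_def arcs_ends_conv image_iff)

lemma graph_hopi_rectangle: "graph (hopi_rectangle a b)"
proof -
  let ?G = "with_proj (grid_graph (a + b))" and ?H = "hopi_rectangle a b"
  interpret pair_graph "grid_graph (a + b)"
    by (rule pair_graph_grid_graph)
  have "induced_subgraph ?H ?G"
    unfolding hopi_rectangle_def by (rule induced_induce) auto
  then have "subgraph ?H ?G" and "symmetric ?H"
    using sym_arcs induced_graph_imp_symmetric by blast+
  interpret H: digraph ?H
    using \<open>subgraph ?H ?G\<close> by (rule digraph_subgraph)
  show ?thesis
    by unfold_locales (rule \<open>symmetric ?H\<close>)
qed

end

theory Submission
  imports Defs
begin

text \<open>
  Put \<open>x = i + j - (a - 1)\<close> and \<open>y = i - j + a\<close>. Then \<open>HD(a, b)\<close> consists of the cells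
  \<open>(x, y)\<close> of \<open>[0, 2b] \<times> [0, 2a]\<close> with \<open>x + y\<close> odd, adjacent when they touch diagonally.
  The \<open>a\<close> rows with \<open>y\<close> odd and the \<open>b\<close> columns with \<open>x\<close> odd partition the cells into
  \<open>a + b\<close> forts (no outside vertex has exactly one neighbor in one of them), so every forcing
  set meets each of them, even without leaks.

  Conversely, the cells with \<open>x = 0\<close> or \<open>y = 0\<close> form a 1-leaky forcing set.  If the leak lies
  in an odd row, sweep row by row: an even row forces the next row from left to
  right without using the leak, while an odd row has one cell more than the next row, which is
  forced from the left end up to the leak and from the right end down to it.  If the
  leak lies in an even row, it lies in an odd column, and one sweeps column by column.
\<close>

section \<open>Forts and stalled colorings\<close>

text \<open>The standard obstruction to zero forcing: an entirely white fort stays white.\<close>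

definition fort :: "('v, 'e) pre_digraph \<Rightarrow> 'v set \<Rightarrow> bool" where
  "fort G F \<longleftrightarrow> F \<noteq> {} \<and> F \<subseteq> verts G \<and>
     (\<forall>u. u \<notin> F \<longrightarrow> (\<forall>v. neighbors G u \<inter> F \<noteq> {v}))"

text \<open>If a force entered \<open>F\<close> while \<open>F\<close> is white, the forced vertex
  would be the only neighbor in \<open>F\<close> of the forcing one, which is blue and hence outside
  \<open>F\<close>.\<close>

lemma force_step_fort_disjoint:
  assumes "force_step G L S T" "fort G F" "S \<inter> F = {}"
  shows "T \<inter> F = {}"
proof (rule ccontr)
  assume T: "T \<inter> F \<noteq> {}"
  obtain u v where uv: "u \<in> S" "neighbors G u - S = {v}" "T = insert v S"
    using assms(1) unfolding force_step_def by blast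
  then have "v \<in> F" using T assms(3) by auto
  then have "neighbors G u \<inter> F = {v}" using uv assms(3) by blast
  moreover have "u \<notin> F" using uv assms(3) by blast
  ultimately show False using assms(2) unfolding fort_def by blast
qed

lemma leaky_forcing_set_meets_fort:
  assumes "leaky_forcing_set l G B" "fort G F"
  shows "B \<inter> F \<noteq> {}"
proof
  assume B: "B \<inter> F = {}"
  \<comment> \<open>The empty leak set is admissible for every \<open>l\<close>.\<close>
  have "(force_step G {})\<^sup>*\<^sup>* B (verts G)"
    using assms(1) unfolding leaky_forcing_set_def by simp
  then have "verts G \<inter> F = {}"
    by (induction rule: rtranclp_induct) (use B force_step_fort_disjoint assms(2) in blast)+
  then show False using assms(2) unfolding fort_def by blast
qed

text \<open>Choose one blue vertex in each fort; disjointness makes the choice injective.\<close>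

lemma disjoint_forts_le_leaky_forcing_number:
  assumes "finite (verts G)" "\<And>k. k \<in> I \<Longrightarrow> fort G (F k)" "disjoint_family_on F I"
  shows "card I \<le> leaky_forcing_number l G"
proof -
  obtain B where B: "leaky_forcing_set l G B" "card B = leaky_forcing_number l G"
    using leaky_forcing_number_attained by blast
  have "\<forall>k\<in>I. \<exists>p. p \<in> B \<inter> F k"
    using leaky_forcing_set_meets_fort[OF B(1) assms(2)] by blast
  then obtain f where f: "\<And>k. k \<in> I \<Longrightarrow> f k \<in> B \<inter> F k" by metis
  have "inj_on f I"
  proof (rule inj_onI, rule ccontr)
    fix j k assume jk: "j \<in> I" "k \<in> I" "f j = f k" "j \<noteq> k"
    then have "F j \<inter> F k = {}" using assms(3) by (simp add: disjoint_family_on_def)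
    then show False using f[OF jk(1)] f[OF jk(2)] jk(3) by auto
  qed
  moreover have "f ` I \<subseteq> B" using f by blast
  moreover have "finite B"
    using B(1) assms(1) finite_subset unfolding leaky_forcing_set_def by blast
  ultimately have "card I \<le> card B" by (rule card_inj_on_le)
  then show ?thesis using B(2) by simp
qed

text \<open>Replaces the construction of a forcing sequence by a closure argument: only supersets of
  \<open>B\<close> admitting no further force have to be examined. Induction on the number of white
  vertices.\<close>

lemma forces_all_if_no_stalled_superset:
  assumes "finite (verts G)" "B \<subseteq> verts G"
    and stalled: "\<And>T. \<lbrakk>B \<subseteq> T; T \<subseteq> verts G;
        \<And>u v. \<lbrakk>u \<in> T; u \<notin> L; v \<in> neighbors G u; neighbors G u - {v} \<subseteq> T\<rbrakk> \<Longrightarrow> v \<in> T\<rbrakk>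
      \<Longrightarrow> T = verts G"
  shows "(force_step G L)\<^sup>*\<^sup>* B (verts G)"
proof -
  have "(force_step G L)\<^sup>*\<^sup>* T (verts G)" if "B \<subseteq> T" "T \<subseteq> verts G" for T
    using that
  proof (induction "card (verts G - T)" arbitrary: T rule: less_induct)
    case less
    show ?case
    proof (cases "T = verts G")
      case False
      then obtain u v where uv: "u \<in> T" "u \<notin> L" "v \<in> neighbors G u" "neighbors G u - {v} \<subseteq> T"
        "v \<notin> T"
        using stalled[OF less.prems] by blast
      have v: "v \<in> verts G" using uv(3) by (simp add: neighbors_def)
      have "neighbors G u - T = {v}" using uv by blast
      then have "force_step G L T (insert v T)" using uv unfolding force_step_def by blast
      moreover have "card (verts G - insert v T) < card (verts G - T)"
        by (rule psubset_card_mono) (use assms(1) v uv(5) in auto)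
      then have "(force_step G L)\<^sup>*\<^sup>* (insert v T) (verts G)"
        using less.hyps less.prems v by blast
      ultimately show ?thesis by (rule converse_rtranclp_into_rtranclp)
    qed simp
  qed
  then show ?thesis using assms(2) by blast
qed

section \<open>Diagonal coordinates\<close>

text \<open>Used with \<open>m = b\<close> and \<open>n = a\<close>; general bounds allow the two
  coordinates to be swapped. Even rows have \<open>m\<close> cells, odd rows
  \<open>m + 1\<close>.\<close>

definition cells :: "int \<Rightarrow> int \<Rightarrow> (int \<times> int) set" where
  "cells m n = {(x, y). 0 \<le> x \<and> x \<le> 2 * m \<and> 0 \<le> y \<and> y \<le> 2 * n \<and> odd (x + y)}"

definition touching :: "int \<times> int \<Rightarrow> int \<times> int \<Rightarrow> bool" where
  "touching p q \<longleftrightarrow> \<bar>fst q - fst p\<bar> = 1 \<and> \<bar>snd q - snd p\<bar> = 1"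

lemma mem_cells:
  "(x, y) \<in> cells m n \<longleftrightarrow> 0 \<le> x \<and> x \<le> 2 * m \<and> 0 \<le> y \<and> y \<le> 2 * n \<and> odd (x + y)"
  by (simp add: cells_def)

lemma touching_iff:
  "touching (x, y) (u, v) \<longleftrightarrow> (u = x + 1 \<or> u = x - 1) \<and> (v = y + 1 \<or> v = y - 1)"
  by (auto simp: touching_def)

text \<open>Here \<open>T\<close> is a coloring, closed under forcing, that contains both axes. By
  \<open>leak\<close>, even rows are free of leaks and an odd row has at most one, in column
  \<open>x0\<close>.\<close>

lemma row_sweep:
  fixes m n :: int
  assumes closed: "\<And>p q. \<lbrakk>p \<in> cells m n; p \<in> T; p \<notin> L; q \<in> cells m n; touching p q;
      \<And>r. \<lbrakk>r \<in> cells m n; touching p r; r \<noteq> q\<rbrakk> \<Longrightarrow> r \<in> T\<rbrakk> \<Longrightarrow> q \<in> T"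
    and left: "\<And>y. (0, y) \<in> cells m n \<Longrightarrow> (0, y) \<in> T"
    and bottom: "\<And>x. (x, 0) \<in> cells m n \<Longrightarrow> (x, 0) \<in> T"
    and leak: "\<And>x y. (x, y) \<in> L \<Longrightarrow> x = x0 \<and> odd y"
  shows "cells m n \<subseteq> T"
proof -
  \<comment> \<open>All rows up to \<open>y\<close> are included, because a forcing cell in row
    \<open>y\<close> also touches row \<open>y - 1\<close>.\<close>
  let ?full = "\<lambda>y. \<forall>u v. (u, v) \<in> cells m n \<longrightarrow> v \<le> y \<longrightarrow> (u, v) \<in> T"
  have even_row: "?full (y + 1)" if full: "?full y" and y: "even y" "0 \<le> y" for y
  proof -
    \<comment> \<open>Left to right: once \<open>(2k, y + 1)\<close> is blue,
      \<open>(2k + 2, y + 1)\<close> is the only neighbor of \<open>(2k + 1, y)\<close> that can be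
      white. The start \<open>k = 0\<close> lies on the left axis.\<close>
    have row: "(2 * int k, y + 1) \<in> cells m n \<longrightarrow> (2 * int k, y + 1) \<in> T" for k
    proof (induction k)
      case 0
      then show ?case using left by simp
    next
      case (Suc k)
      show ?case
      proof
        assume q: "(2 * int (Suc k), y + 1) \<in> cells m n"
        show "(2 * int (Suc k), y + 1) \<in> T"
        proof (rule closed[of "(2 * int k + 1, y)"])
          show p: "(2 * int k + 1, y) \<in> cells m n" using q y by (auto simp: mem_cells)
          show "(2 * int k + 1, y) \<in> T" using p full by simp
          show "(2 * int k + 1, y) \<notin> L" using leak y by blast
          show "touching (2 * int k + 1, y) (2 * int (Suc k), y + 1)"
            by (simp add: touching_iff)
          fix r assume r: "r \<in> cells m n" "touching (2 * int k + 1, y) r"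
            "r \<noteq> (2 * int (Suc k), y + 1)"
          then show "r \<in> T" using Suc full
            by (cases r) (auto simp: touching_iff)
        qed (rule q)
      qed
    qed
    show ?thesis
    proof (intro allI impI)
      fix u v assume c: "(u, v) \<in> cells m n" "v \<le> y + 1"
      show "(u, v) \<in> T"
      proof (cases "v \<le> y")
        case True
        then show ?thesis using c full by blast
      next
        case False
        then have "v = y + 1" using c by simp
        moreover have "u = 2 * int (nat (u div 2))"
          using c y \<open>v = y + 1\<close> by (auto simp: mem_cells)
        ultimately show ?thesis using row[of "nat (u div 2)"] c by simp
      qed
    qed
  qed
  have odd_row: "?full (y + 1)" if full: "?full y" and y: "odd y" "0 \<le> y" for y
  proof -
    \<comment> \<open>The forcing cell is \<open>(2k, y)\<close>, so the bound
      \<open>2k < x0\<close> concerns its column. The corner case \<open>k = 0\<close> works because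
      \<open>(0, y)\<close> has one neighbor in row \<open>y + 1\<close>.\<close>
    have up: "(2 * int k + 1, y + 1) \<in> cells m n \<longrightarrow> 2 * int k < x0 \<longrightarrow>
        (2 * int k + 1, y + 1) \<in> T" for k
    proof (induction k)
      case 0
      show ?case
      proof (intro impI)
        assume q: "(2 * int 0 + 1, y + 1) \<in> cells m n" and x0: "2 * int 0 < x0"
        show "(2 * int 0 + 1, y + 1) \<in> T"
        proof (rule closed[of "(0, y)"])
          show p: "(0, y) \<in> cells m n" using q y by (auto simp: mem_cells)
          show "(0, y) \<in> T" using p full by simp
          show "(0, y) \<notin> L" using leak x0 by force
          show "touching (0, y) (2 * int 0 + 1, y + 1)" by (simp add: touching_iff)
          fix r assume r: "r \<in> cells m n" "touching (0, y) r" "r \<noteq> (2 * int 0 + 1, y + 1)"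
          then show "r \<in> T" using full
            by (cases r) (auto simp: touching_iff mem_cells)
        qed (rule q)
      qed
    next
      case (Suc k)
      show ?case
      proof (intro impI)
        assume q: "(2 * int (Suc k) + 1, y + 1) \<in> cells m n" and x0: "2 * int (Suc k) < x0"
        have IH: "(2 * int k + 1, y + 1) \<in> T"
          using Suc q x0 by (auto simp: mem_cells)
        show "(2 * int (Suc k) + 1, y + 1) \<in> T"
        proof (rule closed[of "(2 * int k + 2, y)"])
          show p: "(2 * int k + 2, y) \<in> cells m n" using q y by (auto simp: mem_cells)
          show "(2 * int k + 2, y) \<in> T" using p full by simp
          show "(2 * int k + 2, y) \<notin> L" using leak x0 by force
          show "touching (2 * int k + 2, y) (2 * int (Suc k) + 1, y + 1)"
            by (simp add: touching_iff)
          fix r assume r: "r \<in> cells m n" "touching (2 * int k + 2, y) r"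
            "r \<noteq> (2 * int (Suc k) + 1, y + 1)"
          then show "r \<in> T" using full IH
            by (cases r) (auto simp: touching_iff add.commute)
        qed (rule q)
      qed
    qed
    \<comment> \<open>Mirror image of \<open>up\<close>: the forcing cell
      \<open>(2m - 2k, y)\<close> lies to the right of \<open>x0\<close>.\<close>
    have down: "(2 * m - 2 * int k - 1, y + 1) \<in> cells m n \<longrightarrow> x0 < 2 * m - 2 * int k \<longrightarrow>
        (2 * m - 2 * int k - 1, y + 1) \<in> T" for k
    proof (induction k)
      case 0
      show ?case
      proof (intro impI)
        assume q: "(2 * m - 2 * int 0 - 1, y + 1) \<in> cells m n" and x0: "x0 < 2 * m - 2 * int 0"
        show "(2 * m - 2 * int 0 - 1, y + 1) \<in> T"
        proof (rule closed[of "(2 * m, y)"])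
          show p: "(2 * m, y) \<in> cells m n" using q y by (auto simp: mem_cells)
          show "(2 * m, y) \<in> T" using p full by simp
          show "(2 * m, y) \<notin> L" using leak x0 by force
          show "touching (2 * m, y) (2 * m - 2 * int 0 - 1, y + 1)" by (simp add: touching_iff)
          fix r assume r: "r \<in> cells m n" "touching (2 * m, y) r"
            "r \<noteq> (2 * m - 2 * int 0 - 1, y + 1)"
          then show "r \<in> T" using full
            by (cases r) (auto simp: touching_iff mem_cells)
        qed (rule q)
      qed
    next
      case (Suc k)
      show ?case
      proof (intro impI)
        assume q: "(2 * m - 2 * int (Suc k) - 1, y + 1) \<in> cells m n"
          and x0: "x0 < 2 * m - 2 * int (Suc k)"
        have IH: "(2 * m - 2 * int k - 1, y + 1) \<in> T"
          using Suc q x0 by (auto simp: mem_cells)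
        show "(2 * m - 2 * int (Suc k) - 1, y + 1) \<in> T"
        proof (rule closed[of "(2 * m - 2 * int k - 2, y)"])
          show p: "(2 * m - 2 * int k - 2, y) \<in> cells m n"
            using q y by (auto simp: mem_cells)
          show "(2 * m - 2 * int k - 2, y) \<in> T" using p full by simp
          show "(2 * m - 2 * int k - 2, y) \<notin> L" using leak x0 by force
          show "touching (2 * m - 2 * int k - 2, y) (2 * m - 2 * int (Suc k) - 1, y + 1)"
            by (simp add: touching_iff)
          fix r assume r: "r \<in> cells m n" "touching (2 * m - 2 * int k - 2, y) r"
            "r \<noteq> (2 * m - 2 * int (Suc k) - 1, y + 1)"
          then show "r \<in> T" using full IH
            by (cases r) (auto simp: touching_iff)
        qed (rule q)
      qed
    qed
    show ?thesis
    proof (intro allI impI)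
      fix u v assume c: "(u, v) \<in> cells m n" "v \<le> y + 1"
      show "(u, v) \<in> T"
      proof (cases "v \<le> y")
        case True
        then show ?thesis using c full by blast
      next
        case False
        then have v: "v = y + 1" using c by simp
        then have u: "odd u" "0 \<le> u" "u \<le> 2 * m" using c y by (auto simp: mem_cells)
        show ?thesis
        \<comment> \<open>\<open>u\<close> is forced from \<open>u - 1 < x0\<close> in the first
          case and from \<open>u + 1 > x0\<close> in the second, so no cell is missed.\<close>
        proof (cases "u \<le> x0")
          case True
          have "u = 2 * int (nat (u div 2)) + 1" using u by simp
          then show ?thesis using up[of "nat (u div 2)"] c v True by simp
        next
          case False
          have "even (2 * m - u - 1)" "0 \<le> 2 * m - u - 1" using u by presburger+
          then have "u = 2 * m - 2 * int (nat ((2 * m - u - 1) div 2)) - 1" by auto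
          then show ?thesis
            using down[of "nat ((2 * m - u - 1) div 2)"] c v False by simp
        qed
      qed
    qed
  qed
  have "?full (int k)" for k
  proof (induction k)
    case 0
    then show ?case using bottom by (auto simp: mem_cells)
  next
    case (Suc k)
    have "?full (int k + 1)"
    proof (cases "even k")
      case True
      then show ?thesis by (intro even_row[OF Suc]) simp_all
    next
      case False
      then show ?thesis by (intro odd_row[OF Suc]) simp_all
    qed
    moreover have "int (Suc k) = int k + 1" by simp
    ultimately show ?case by (simp only:)
  qed
  from this[of "nat (2 * n)"] show ?thesis by (auto simp: mem_cells)
qed

lemma swap_cells: "prod.swap p \<in> cells m n \<longleftrightarrow> p \<in> cells n m"
  by (cases p) (auto simp: mem_cells add.commute)

lemma swap_touching: "touching (prod.swap p) q \<longleftrightarrow> touching p (prod.swap q)"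
  by (auto simp: touching_def)

text \<open>Reflection in the diagonal exchanges rows with columns and the left axis with the bottom
  one, reducing this to \<open>row_sweep\<close>.\<close>

lemma column_sweep:
  fixes m n :: int
  assumes closed: "\<And>p q. \<lbrakk>p \<in> cells m n; p \<in> T; p \<notin> L; q \<in> cells m n; touching p q;
      \<And>r. \<lbrakk>r \<in> cells m n; touching p r; r \<noteq> q\<rbrakk> \<Longrightarrow> r \<in> T\<rbrakk> \<Longrightarrow> q \<in> T"
    and left: "\<And>y. (0, y) \<in> cells m n \<Longrightarrow> (0, y) \<in> T"
    and bottom: "\<And>x. (x, 0) \<in> cells m n \<Longrightarrow> (x, 0) \<in> T"
    and leak: "\<And>x y. (x, y) \<in> L \<Longrightarrow> y = y0 \<and> odd x"
  shows "cells m n \<subseteq> T"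
proof -
  have "cells n m \<subseteq> {p. prod.swap p \<in> T}"
  proof (rule row_sweep[where L = "{p. prod.swap p \<in> L}" and ?x0.0 = y0])
    fix p q
    assume p: "p \<in> cells n m" "p \<in> {p. prod.swap p \<in> T}" "p \<notin> {p. prod.swap p \<in> L}"
      and q: "q \<in> cells n m" "touching p q"
      and others: "\<And>r. \<lbrakk>r \<in> cells n m; touching p r; r \<noteq> q\<rbrakk> \<Longrightarrow> r \<in> {p. prod.swap p \<in> T}"
    have "prod.swap q \<in> T"
    proof (rule closed[of "prod.swap p"])
      fix r assume "r \<in> cells m n" "touching (prod.swap p) r" "r \<noteq> prod.swap q"
      then show "r \<in> T"
        using others[of "prod.swap r"] by (metis mem_Collect_eq swap_cells swap_swap swap_touching)
    qed (use p q in \<open>auto simp: swap_cells swap_touching\<close>)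
    then show "q \<in> {p. prod.swap p \<in> T}" by simp
  next
    fix x y assume "(x, y) \<in> {p. prod.swap p \<in> L}"
    then show "x = y0 \<and> odd y" using leak by simp
  qed (use left bottom in \<open>auto simp: mem_cells\<close>)
  then show ?thesis using swap_cells by fastforce
qed

text \<open>The halved terms are even whenever \<open>x + y\<close> is odd.\<close>

definition vertex_at :: "int \<Rightarrow> int \<times> int \<Rightarrow> int \<times> int" where
  "vertex_at a p = ((fst p + snd p - 1) div 2, (fst p - snd p + 2 * a - 1) div 2)"

definition cell_of :: "int \<Rightarrow> int \<times> int \<Rightarrow> int \<times> int" where
  "cell_of a v = (fst v + snd v - (a - 1), fst v - snd v + a)"

lemma vertex_at_cell_of: "vertex_at a (cell_of a v) = v"
  by (cases v) (auto simp: vertex_at_def cell_of_def)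

lemma cell_of_vertex_at: "p \<in> cells m n \<Longrightarrow> cell_of a (vertex_at a p) = p"
  by (cases p) (simp add: vertex_at_def cell_of_def mem_cells, presburger)

text \<open>The bounds of the surrounding square follow from the diagonal ones: adding these gives
  \<open>-1 \<le> 2 * i \<le> 2 * (a + b) - 1\<close>, likewise for \<open>j\<close>, and both are
  integers.\<close>

lemma cell_of_mem_cells:
  "cell_of (int a) v \<in> cells (int b) (int a) \<longleftrightarrow> v \<in> verts (hopi_rectangle a b)"
proof -
  obtain i j where v: "v = (i, j)" by fastforce
  have "odd (i + j - (int a - 1) + (i - j + int a))" by presburger
  then show ?thesis by (auto simp: v cell_of_def mem_cells verts_hopi_rectangle)
qed

text \<open>A displacement \<open>(d, e)\<close> in the grid becomes \<open>(d + e, d - e)\<close>,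
  with both entries \<open>1\<close> or \<open>-1\<close> exactly for unit grid steps.\<close>

lemma touching_cell_of:
  "touching (cell_of a u) (cell_of a v) \<longleftrightarrow>
     (fst v - fst u, snd v - snd u) \<in> {(1, 0), (-1, 0), (0, 1), (0, -1)}"
proof -
  have "\<bar>d + e\<bar> = 1 \<and> \<bar>d - e\<bar> = 1 \<longleftrightarrow>
      d = 1 \<and> e = 0 \<or> d = -1 \<and> e = 0 \<or> d = 0 \<and> e = 1 \<or> d = 0 \<and> e = -1"
    for d e :: int by presburger
  from this[of "fst v - fst u" "snd v - snd u"] show ?thesis
    by (simp add: touching_def cell_of_def algebra_simps)
qed

lemma neighbors_hopi_rectangle:
  assumes "u \<in> verts (hopi_rectangle a b)"
  shows "v \<in> neighbors (hopi_rectangle a b) u \<longleftrightarrow>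
    cell_of (int a) v \<in> cells (int b) (int a) \<and> touching (cell_of (int a) u) (cell_of (int a) v)"
  using assms unfolding neighbors_def cell_of_mem_cells touching_cell_of
  by (auto simp: dominates_hopi_rectangle)

section \<open>Lower and upper bound\<close>

lemma finite_verts_hopi_rectangle: "finite (verts (hopi_rectangle a b))"
proof -
  interpret graph "hopi_rectangle a b" by (rule graph_hopi_rectangle)
  show ?thesis by simp
qed

text \<open>Moves the fort condition to diagonal coordinates, where a lone neighbor is excluded by
  exhibiting a companion in \<open>C\<close>.\<close>

lemma fort_hopi_rectangleI:
  assumes "C \<noteq> {}" "C \<subseteq> cells (int b) (int a)"
    and partner: "\<And>p q. \<lbrakk>p \<in> cells (int b) (int a); q \<in> C; touching p q\<rbrakk>
      \<Longrightarrow> \<exists>r\<in>C. r \<noteq> q \<and> touching p r"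
  shows "fort (hopi_rectangle a b) {v. cell_of (int a) v \<in> C}" (is "fort ?G ?F")
proof -
  have inv: "cell_of (int a) (vertex_at (int a) p) = p" if "p \<in> C" for p
    using that assms(2) cell_of_vertex_at by blast
  obtain p where "p \<in> C" using assms(1) by blast
  then have "vertex_at (int a) p \<in> ?F" by (simp add: inv)
  moreover have "?F \<subseteq> verts ?G" using assms(2) by (auto simp flip: cell_of_mem_cells)
  moreover have "neighbors ?G u \<inter> ?F \<noteq> {v}" for u v
  proof
    assume uv: "neighbors ?G u \<inter> ?F = {v}"
    then have v: "v \<in> neighbors ?G u" "cell_of (int a) v \<in> C" by auto
    have u: "u \<in> verts ?G"
      using v(1) by (simp add: neighbors_def dominates_hopi_rectangle)
    then obtain r where r: "r \<in> C" "r \<noteq> cell_of (int a) v" "touching (cell_of (int a) u) r"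
      using partner v neighbors_hopi_rectangle[OF u] by (meson cell_of_mem_cells)
    have "vertex_at (int a) r \<in> neighbors ?G u \<inter> ?F"
      using r assms(2) by (auto simp: neighbors_hopi_rectangle[OF u] inv)
    then have "vertex_at (int a) r = v" using uv by blast
    then show False using r inv by metis
  qed
  ultimately show ?thesis unfolding fort_def by blast
qed

lemma fort_odd_row:
  assumes "odd y" "0 \<le> y" "y \<le> 2 * int a"
  shows "fort (hopi_rectangle a b) {v. cell_of (int a) v \<in> {p \<in> cells (int b) (int a). snd p = y}}"
proof (rule fort_hopi_rectangleI)
  have "(0, y) \<in> cells (int b) (int a)" using assms by (auto simp: mem_cells)
  then show "{p \<in> cells (int b) (int a). snd p = y} \<noteq> {}" by force
next
  fix p q
  assume *: "p \<in> cells (int b) (int a)" "q \<in> {p \<in> cells (int b) (int a). snd p = y}"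
    "touching p q"
  have "odd (fst p)" using * assms by (cases p; cases q) (auto simp: mem_cells touching_iff)
  \<comment> \<open>The companion of \<open>q\<close> is its reflection in the column of
    \<open>p\<close>. It stays in range since \<open>fst p\<close> is odd and thus strictly between
    \<open>0\<close> and \<open>2b\<close>.\<close>
  then have "(2 * fst p - fst q, y) \<in> cells (int b) (int a)"
    using * by (cases p; cases q) (auto simp: mem_cells touching_iff, presburger+)
  then show "\<exists>r\<in>{p \<in> cells (int b) (int a). snd p = y}. r \<noteq> q \<and> touching p r"
    using * by (intro bexI[of _ "(2 * fst p - fst q, y)"]; cases q) (auto simp: touching_def)
qed auto

lemma fort_odd_column:
  assumes "odd x" "0 \<le> x" "x \<le> 2 * int b"
  shows "fort (hopi_rectangle a b) {v. cell_of (int a) v \<in> {p \<in> cells (int b) (int a). fst p = x}}"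
proof (rule fort_hopi_rectangleI)
  have "(x, 0) \<in> cells (int b) (int a)" using assms by (auto simp: mem_cells)
  then show "{p \<in> cells (int b) (int a). fst p = x} \<noteq> {}" by force
next
  fix p q
  assume *: "p \<in> cells (int b) (int a)" "q \<in> {p \<in> cells (int b) (int a). fst p = x}"
    "touching p q"
  have "odd (snd p)" using * assms by (cases p; cases q) (auto simp: mem_cells touching_iff)
  then have "(x, 2 * snd p - snd q) \<in> cells (int b) (int a)"
    using * by (cases p; cases q) (auto simp: mem_cells touching_iff, presburger+)
  then show "\<exists>r\<in>{p \<in> cells (int b) (int a). fst p = x}. r \<noteq> q \<and> touching p r"
    using * by (intro bexI[of _ "(x, 2 * snd p - snd q)"]; cases q) (auto simp: touching_def)
qed auto

section \<open>Lower bound from the odd rows and columns\<close>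

lemma leaky_forcing_number_hopi_rectangle_ge:
  "a + b \<le> leaky_forcing_number l (hopi_rectangle a b)"
proof -
  define F where "F k = {v. cell_of (int a) v \<in>
    (if k < a then {p \<in> cells (int b) (int a). snd p = 2 * int k + 1}
     else {p \<in> cells (int b) (int a). fst p = 2 * int (k - a) + 1})}" for k
  have "card {..<a + b} \<le> leaky_forcing_number l (hopi_rectangle a b)"
  proof (rule disjoint_forts_le_leaky_forcing_number)
    show "fort (hopi_rectangle a b) (F k)" if "k \<in> {..<a + b}" for k
      using that fort_odd_row[of "2 * int k + 1" a b] fort_odd_column[of "2 * int (k - a) + 1" b a]
      by (auto simp: F_def)
    \<comment> \<open>An odd row and an odd column share no cell, since \<open>x + y\<close> is odd
      for every cell.\<close>
    have "j = k" if "v \<in> F j" "v \<in> F k" for v j k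
      using that by (auto simp: F_def cells_def split: if_splits)
    then show "disjoint_family_on F {..<a + b}"
      unfolding disjoint_family_on_def by blast
  qed (rule finite_verts_hopi_rectangle)
  then show ?thesis by simp
qed

section \<open>Upper bound from the two axes\<close>

lemma axes_leaky_forcing_set:
  "leaky_forcing_set 1 (hopi_rectangle a b)
     {v. cell_of (int a) v \<in> {(x, y) \<in> cells (int b) (int a). x = 0 \<or> y = 0}}"
  (is "leaky_forcing_set 1 ?G ?B")
  unfolding leaky_forcing_set_def
proof (intro conjI allI impI)
  show B: "?B \<subseteq> verts ?G" by (auto simp flip: cell_of_mem_cells)
  fix L :: "(int \<times> int) set"
  assume L: "L \<subseteq> verts ?G \<and> card L \<le> 1"
  show "(force_step ?G L)\<^sup>*\<^sup>* ?B (verts ?G)"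
  proof (rule forces_all_if_no_stalled_superset[OF finite_verts_hopi_rectangle B])
    fix T
    assume T: "?B \<subseteq> T" "T \<subseteq> verts ?G"
      and stalled: "\<And>u v. \<lbrakk>u \<in> T; u \<notin> L; v \<in> neighbors ?G u; neighbors ?G u - {v} \<subseteq> T\<rbrakk> \<Longrightarrow> v \<in> T"
    let ?T = "{p. vertex_at (int a) p \<in> T}"
    let ?L = "cell_of (int a) ` L"
    have closed: "q \<in> ?T"
      if p: "p \<in> cells (int b) (int a)" "p \<in> ?T" "p \<notin> ?L"
        and q: "q \<in> cells (int b) (int a)" "touching p q"
        and others: "\<And>r. \<lbrakk>r \<in> cells (int b) (int a); touching p r; r \<noteq> q\<rbrakk> \<Longrightarrow> r \<in> ?T" for p q
    proof -
      have u: "vertex_at (int a) p \<in> verts ?G"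
        using p by (simp add: cell_of_vertex_at flip: cell_of_mem_cells)
      have "vertex_at (int a) q \<in> T"
      proof (rule stalled[of "vertex_at (int a) p"])
        show "vertex_at (int a) p \<in> T" using p by simp
        show "vertex_at (int a) p \<notin> L" using p cell_of_vertex_at by (metis imageI)
        show "vertex_at (int a) q \<in> neighbors ?G (vertex_at (int a) p)"
          using p q by (simp add: neighbors_hopi_rectangle[OF u] cell_of_vertex_at)
        show "neighbors ?G (vertex_at (int a) p) - {vertex_at (int a) q} \<subseteq> T"
        proof
          fix v assume v: "v \<in> neighbors ?G (vertex_at (int a) p) - {vertex_at (int a) q}"
          then have "cell_of (int a) v \<noteq> q" using vertex_at_cell_of[of "int a" v] by auto
          then show "v \<in> T"
            using v p others[of "cell_of (int a) v"]
            by (simp add: neighbors_hopi_rectangle[OF u] cell_of_vertex_at vertex_at_cell_of)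
        qed
      qed
      then show ?thesis by simp
    qed
    have left: "(0, y) \<in> ?T" if "(0, y) \<in> cells (int b) (int a)" for y
      using that T by (auto simp: cell_of_vertex_at)
    have bottom: "(x, 0) \<in> ?T" if "(x, 0) \<in> cells (int b) (int a)" for x
      using that T by (auto simp: cell_of_vertex_at)
    have "finite L" using L finite_verts_hopi_rectangle by (metis finite_subset)
    then have "\<forall>v\<in>L. \<forall>w\<in>L. v = w" using L card_le_Suc0_iff_eq by (metis One_nat_def)
    \<comment> \<open>If \<open>L\<close> is empty, \<open>w\<close> is arbitrary and the leak
      hypothesis of either sweep holds vacuously.\<close>
    then obtain w where "L \<subseteq> {w}" by blast
    then obtain x0 y0 where sub: "?L \<subseteq> {(x0, y0)}"
      by (cases "cell_of (int a) w") blast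
    have "cells (int b) (int a) \<subseteq> ?T"
    proof (cases "odd y0")
      case True
      then show ?thesis by (intro row_sweep[OF closed left bottom, where ?x0.0 = x0])
        (use sub in auto)
    next
      case False
      \<comment> \<open>A leak is a cell, so an even row coordinate makes its column coordinate
        odd.\<close>
      have "y = y0 \<and> odd x" if "(x, y) \<in> ?L" for x y
      proof -
        have "(x, y) \<in> cells (int b) (int a)"
          using that L cell_of_mem_cells by (metis imageE subsetD)
        then show ?thesis using that sub False by (auto simp: mem_cells)
      qed
      then show ?thesis by (intro column_sweep[OF closed left bottom])
    qed
    then have "cell_of (int a) v \<in> ?T" if "v \<in> verts ?G" for v
      by (rule subsetD) (simp add: cell_of_mem_cells that)
    then show "T = verts ?G"
      using T(2) by (auto simp: vertex_at_cell_of)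
  qed
qed

text \<open>The \<open>a\<close> cells on the left axis and the \<open>b\<close> cells on the bottom
  one are enumerated by \<open>g\<close>. An upper estimate suffices, as the forts supply the
  opposite inequality.\<close>

lemma card_axes_le:
  "card {v. cell_of (int a) v \<in> {(x, y) \<in> cells (int b) (int a). x = 0 \<or> y = 0}} \<le> a + b"
  (is "card ?B \<le> _")
proof -
  define g where "g k = vertex_at (int a)
    (if k < a then (0, 2 * int k + 1) else (2 * int (k - a) + 1, 0))" for k
  have "?B \<subseteq> g ` {..<a + b}"
  proof
    fix v assume v: "v \<in> ?B"
    obtain x y where c: "cell_of (int a) v = (x, y)" by fastforce
    then have xy: "(x, y) \<in> cells (int b) (int a)" "x = 0 \<or> y = 0" using v by auto
    have "\<exists>k<a + b. (x, y) = (if k < a then (0, 2 * int k + 1) else (2 * int (k - a) + 1, 0))"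
    proof (cases "x = 0")
      case True
      then have y: "odd y" "0 \<le> y" "y \<le> 2 * int a" using xy by (auto simp: mem_cells)
      then have "y div 2 < int a" by presburger
      then show ?thesis using True y by (intro exI[of _ "nat (y div 2)"]) auto
    next
      case False
      then have x: "y = 0" "odd x" "0 \<le> x" "x \<le> 2 * int b" using xy by (auto simp: mem_cells)
      then have "x div 2 < int b" by presburger
      then show ?thesis using x by (intro exI[of _ "a + nat (x div 2)"]) auto
    qed
    moreover have "v = vertex_at (int a) (x, y)" using c vertex_at_cell_of by metis
    ultimately show "v \<in> g ` {..<a + b}" by (auto simp: g_def)
  qed
  then have "card ?B \<le> card {..<a + b}"
    by (meson card_image_le card_mono finite_imageI finite_lessThan order_trans)
  then show ?thesis by simp
qed

theorem theorem18:
  fixes a b :: nat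
  assumes "a > 0" and "b > 0"
  shows "leaky_forcing_number 1 (hopi_rectangle a b) = a + b"
  using leaky_forcing_number_le[OF axes_leaky_forcing_set[of a b]] card_axes_le[of a b]
    leaky_forcing_number_hopi_rectangle_ge[of a b 1]
  by linarith

end
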